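(* Let $n$ be a positive integer and $w_1=\left[\begin{matrix} k_1\\ x_1\end{matrix}\right],\ldots,w_n=\left[\begin{matrix} k_n\\ x_n\end{matrix}\right]\in\mathcal{M}$. Set $\mathbf{k}=(k_1,\ldots,k_n)$ and $\mathbf{x}=(x_1,\ldots,x_n)$. Then in $\mathfrak{h}^1$, $$w_1\bar\ast\cdots\bar\ast w_n=\sum_{\substack{\mathbf{l}=(k_{i_1},\ldots,k_{i_m})\in \mathrm{Sub}(\mathbf{k})\\ \mathbf{l}\neq\mathbf{k}}}(-1)^{n-m-1}\left[\begin{matrix} \mathrm{wt}(\mathbf{k})-\mathrm{wt}(\mathbf{l})\\ |\mathbf{x}|/|\mathbf{x}_{\mathbf{l}}|\end{matrix}\right]\left(w_{i_1}\bar\ast\cdots\bar\ast w_{i_m}\right).$$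
   Context: Let $\mathcal{M}=\{\left[\begin{matrix} k\\ x\end{matrix}\right] : (k,x)\in\mathbb{N}\times(-1,1)\}$, viewed as an alphabet of noncommuting letters, with empty word $1_{\mathcal{M}}$; $\mathfrak{h}^1=\mathbb{Q}\langle\mathcal{M}\rangle$. The stuffle product $\bar\ast$ on $\mathfrak{h}^1$ is the $\mathbb{Q}$-bilinear product with $1_{\mathcal{M}}\bar\ast w=w\bar\ast 1_{\mathcal{M}}=w$ and $au\bar\ast bv=a(u\bar\ast bv)+b(au\bar\ast v)-(a\circ b)(u\bar\ast v)$ for letters $a,b$ and words $u,v$, where $\left[\begin{matrix} k\\ x\end{matrix}\right]\circ\left[\begin{matrix} l\\ y\end{matrix}\right]=\left[\begin{matrix} k+l\\ xy\end{matrix}\right]$. For $\mathbf{k}=(k_1,\ldots,k_n)$, $\mathrm{wt}(\mathbf{k})=k_1+\cdots+k_n$; $\mathrm{Sub}(\mathbf{k})$ is the set of subsequences $(k_{i_1},\ldots,k_{i_m})$ with $0\le m\le n$, $1\le i_1<\cdots<i_m\le n$ (subsequences are indexed by their index sets; the empty one has weight $0$). For $\mathbf{l}=(k_{i_1},\ldots,k_{i_m})$, $\mathbf{x}_{\mathbf{l}}=(x_{i_1},\ldots,x_{i_m})$, and $|\mathbf{y}|$ denotes the product of the entries of $\mathbf{y}$ (with $|\varnothing|=1$). For $m=0$ the product $w_{i_1}\bar\ast\cdots\bar\ast w_{i_m}$ is $1_{\mathcal{M}}$.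
   Formalization: Since some x_i may be 0, the quotient |x|/|x_l| can be 0/0 and undefined; it is replaced by the product of the x_i whose index i is not among i_1,…,i_m, which equals the quotient whenever |x_l| is nonzero. *)

theory Defs
  imports Complex_Main "HOL-Library.Poly_Mapping"
begin

typedef letter = "{(k, x). 0 < k \<and> -1 < x \<and> x < 1} :: (nat \<times> real) set"
  by (rule exI[of _ "(1, 0)"]) auto

setup_lifting type_definition_letter

text \<open>Only meaningful for \<open>0 < k\<close> and \<open>-1 < x < 1\<close>; unspecified otherwise.\<close>
definition mk_letter :: "nat \<Rightarrow> real \<Rightarrow> letter" where
  "mk_letter k x = Abs_letter (k, x)"

lemma abs_mult_less_one: "\<bar>x * y\<bar> < 1" if "\<bar>x\<bar> < 1" "\<bar>y\<bar> < 1" for x y :: real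
  using mult_strict_mono'[of "\<bar>x\<bar>" 1 "\<bar>y\<bar>" 1] that by (simp add: abs_mult)

lift_definition letter_circ :: "letter \<Rightarrow> letter \<Rightarrow> letter"
  is "\<lambda>(k, x) (l, y). (k + l, x * y)"
  using abs_mult_less_one by (fastforce simp: abs_less_iff)

lemma letter_circ_mk_letter:
  assumes "0 < k" "-1 < x" "x < 1" "0 < l" "-1 < y" "y < 1"
  shows "letter_circ (mk_letter k x) (mk_letter l y) = mk_letter (k + l) (x * y)"
  using assms by (simp add: mk_letter_def letter_circ.abs_eq eq_onp_def)

text \<open>
  The free monoid on the letters, written additively because the convolution product of
  finitely supported functions is indexed by an additive monoid.
\<close>
datatype word = Word "letter list"

instantiation word :: monoid_add
begin

definition zero_word :: word where "0 = Word []"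

fun plus_word :: "word \<Rightarrow> word \<Rightarrow> word" where
  "Word u + Word v = Word (u @ v)"

instance
proof
  fix a b c :: word
  show "a + b + c = a + (b + c)" by (cases a; cases b; cases c) simp
  show "0 + a = a" by (cases a) (simp add: zero_word_def)
  show "a + 0 = a" by (cases a) (simp add: zero_word_def)
qed

end

text \<open>
  The free algebra as the monoid algebra of the free monoid: \<open>*\<close> is the bilinear extension
  of concatenation and \<open>1\<close> is the empty word.
\<close>
type_synonym h1 = "word \<Rightarrow>\<^sub>0 rat"

definition of_word :: "letter list \<Rightarrow> h1" where
  "of_word u = Poly_Mapping.single (Word u) 1"

abbreviation of_letter :: "letter \<Rightarrow> h1" where
  "of_letter a \<equiv> of_word [a]"

definition scalar :: "rat \<Rightarrow> h1" where
  "scalar c = Poly_Mapping.single 0 c"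

lemma of_word_Nil: "of_word [] = 1"
  by (simp add: of_word_def zero_word_def[symmetric])

lemma of_word_append: "of_word (u @ v) = of_word u * of_word v"
  by (simp add: of_word_def mult_single)

fun stuffle_words :: "letter list \<Rightarrow> letter list \<Rightarrow> h1" where
  "stuffle_words [] v = of_word v"
| "stuffle_words u [] = of_word u"
| "stuffle_words (a # u) (b # v) =
     of_letter a * stuffle_words u (b # v) + of_letter b * stuffle_words (a # u) v
     - of_letter (letter_circ a b) * stuffle_words u v"

fun letters :: "word \<Rightarrow> letter list" where
  "letters (Word u) = u"

definition stuffle :: "h1 \<Rightarrow> h1 \<Rightarrow> h1" (infixr "\<circledast>" 70) where
  "p \<circledast> q = (\<Sum>u\<in>Poly_Mapping.keys p. \<Sum>v\<in>Poly_Mapping.keys q.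
     scalar (Poly_Mapping.lookup p u * Poly_Mapping.lookup q v)
       * stuffle_words (letters u) (letters v))"

lemma stuffle_of_word: "of_word u \<circledast> of_word v = stuffle_words u v"
  by (simp add: stuffle_def of_word_def scalar_def)

lemma scalar_add: "scalar (c + d) = scalar c + scalar d"
  and scalar_mult: "scalar (c * d) = scalar c * scalar d"
  and scalar_0: "scalar 0 = 0"
  and scalar_1: "scalar 1 = 1"
  by (simp_all add: scalar_def single_add mult_single)

lemma lookup_scalar_mult:
  "Poly_Mapping.lookup (scalar c * p) u = c * Poly_Mapping.lookup p u"
  unfolding scalar_def by (simp add: mult_map_scale_conv_mult[symmetric] Poly_Mapping.map.rep_eq when_def)

lemma stuffle_superset:
  assumes "finite A" "Poly_Mapping.keys p \<subseteq> A" "finite B" "Poly_Mapping.keys q \<subseteq> B"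
  shows "p \<circledast> q = (\<Sum>u\<in>A. \<Sum>v\<in>B.
     scalar (Poly_Mapping.lookup p u * Poly_Mapping.lookup q v)
       * stuffle_words (letters u) (letters v))"
proof -
  have inner: "(\<Sum>v\<in>Poly_Mapping.keys q. scalar (Poly_Mapping.lookup p u * Poly_Mapping.lookup q v)
       * stuffle_words (letters u) (letters v)) = (\<Sum>v\<in>B.
     scalar (Poly_Mapping.lookup p u * Poly_Mapping.lookup q v)
       * stuffle_words (letters u) (letters v))" for u
    using assms by (intro sum.mono_neutral_left) (auto simp: in_keys_iff scalar_0)
  show ?thesis
    unfolding stuffle_def inner
    using assms by (intro sum.mono_neutral_left) (auto simp: in_keys_iff scalar_0)
qed

lemma stuffle_add_left: "(p + p') \<circledast> q = p \<circledast> q + p' \<circledast> q"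
proof -
  let ?A = "Poly_Mapping.keys p \<union> Poly_Mapping.keys p'"
  have k: "Poly_Mapping.keys (p + p') \<subseteq> ?A" by (rule Poly_Mapping.keys_add)
  have f: "finite ?A" by simp
  show ?thesis
    unfolding stuffle_superset[OF f k finite_keys order.refl]
      stuffle_superset[OF f Un_upper1 finite_keys order.refl]
      stuffle_superset[OF f Un_upper2 finite_keys order.refl]
    by (simp add: lookup_add distrib_right scalar_add sum.distrib)
qed

lemma stuffle_add_right: "q \<circledast> (p + p') = q \<circledast> p + q \<circledast> p'"
proof -
  let ?A = "Poly_Mapping.keys p \<union> Poly_Mapping.keys p'"
  have k: "Poly_Mapping.keys (p + p') \<subseteq> ?A" by (rule Poly_Mapping.keys_add)
  have f: "finite ?A" by simp
  show ?thesis
    unfolding stuffle_superset[OF finite_keys order.refl f k]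
      stuffle_superset[OF finite_keys order.refl f Un_upper1]
      stuffle_superset[OF finite_keys order.refl f Un_upper2]
    by (simp add: lookup_add distrib_left distrib_right scalar_add sum.distrib)
qed

lemma stuffle_scalar_left: "(scalar c * p) \<circledast> q = scalar c * (p \<circledast> q)"
proof -
  have k: "Poly_Mapping.keys (scalar c * p) \<subseteq> Poly_Mapping.keys p"
    by (auto simp: in_keys_iff lookup_scalar_mult)
  show ?thesis
    unfolding stuffle_superset[OF finite_keys k finite_keys order.refl] stuffle_def[of p]
    by (simp add: lookup_scalar_mult scalar_mult sum_distrib_left mult.assoc)
qed

lemma stuffle_scalar_right: "q \<circledast> (scalar c * p) = scalar c * (q \<circledast> p)"
proof -
  have k: "Poly_Mapping.keys (scalar c * p) \<subseteq> Poly_Mapping.keys p"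
    by (auto simp: in_keys_iff lookup_scalar_mult)
  have s: "scalar (d * (c * e)) = scalar c * scalar (d * e)" for d e
    by (simp add: scalar_mult[symmetric] mult.left_commute)
  show ?thesis
    unfolding stuffle_superset[OF finite_keys order.refl finite_keys k] stuffle_def[of q p]
    by (simp add: lookup_scalar_mult s sum_distrib_left mult.assoc)
qed

text \<open>
  The stuffle product of the letters \<open>w i\<close> over a finite index set, in increasing order of
  indices, bracketed to the right and ending in the unit \<open>1\<close> (the value on the empty set).
\<close>
definition stuffle_prod :: "(nat \<Rightarrow> letter) \<Rightarrow> nat set \<Rightarrow> h1" where
  "stuffle_prod w I = foldr (\<lambda>i p. of_letter (w i) \<circledast> p) (sorted_list_of_set I) 1"

end

theory Submission
  imports Defs
begin

text \<open>
  Induction on the number of factors. For a letter \<open>a\<close> the recursion of the stuffle product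
  extends linearly to \<open>a \<circledast> b p = a b p + b (a \<circledast> p) - (a \<circ> b) p\<close> for a letter \<open>b\<close> and every \<open>p\<close>.
  Multiplying the formula for \<open>S\<close> by a further letter \<open>w i\<close>, the three terms contribute the
  summands of the formula for \<open>insert i S\<close> indexed by \<open>S\<close> itself, by the proper subsets
  containing \<open>i\<close>, and by the proper subsets of \<open>S\<close>, respectively.
\<close>

lemma of_word_scalar_commute: "of_word u * scalar c = scalar c * of_word u"
  by (simp add: of_word_def scalar_def mult_single)

lemma scalar_minus: "scalar (- c) = - scalar c"
  by (simp add: scalar_def single_uminus)

text \<open>A finitely supported function is built up one key at a time, so the scalar multiples of
  words generate \<open>h1\<close> additively. This reduces identities linear in \<open>p\<close> to
  words.\<close>

lemma h1_induct [case_names add word]: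
  assumes "\<And>p q. P p \<Longrightarrow> P q \<Longrightarrow> P (p + q)" "\<And>c u. P (scalar c * of_word u)"
  shows "P (p :: h1)"
proof (induction p rule: update_induct)
  case const
  \<comment> \<open>Zero is obtained as the scalar 0 times the empty word.\<close>
  show ?case using assms(2)[of 0 "[]"] by (simp add: scalar_0)
next
  case (update f u c)
  have "Poly_Mapping.update u c f = f + Poly_Mapping.single u c"
    using update.hyps by (intro poly_mapping_eqI) (auto simp: lookup_update lookup_add lookup_single in_keys_iff)
  moreover have "Poly_Mapping.single u c = scalar c * of_word (letters u)"
    by (cases u) (simp add: scalar_def of_word_def mult_single)
  ultimately show ?case using update.IH by (simp add: assms)
qed

text \<open>Both sides are linear in \<open>p\<close>. On a word this is the defining recursion with
  the one-letter word \<open>[a]\<close> on the left, whose tail is empty, so two of the three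
  recursive calls return plain words.\<close>

lemma stuffle_letter_mult:
  "of_letter a \<circledast> (of_letter b * p) =
     of_letter a * of_letter b * p + of_letter b * (of_letter a \<circledast> p)
     - of_letter (letter_circ a b) * p"
proof (induction p rule: h1_induct)
  case (add p q)
  then show ?case by (simp add: distrib_left stuffle_add_right)
next
  case (word c u)
  have c: "of_word v * (scalar c * r) = scalar c * (of_word v * r)" for v r
    by (simp add: of_word_scalar_commute flip: mult.assoc)
  have "of_letter a \<circledast> of_word (b # u) =
     of_letter a * of_word (b # u) + of_letter b * (of_letter a \<circledast> of_word u)
     - of_letter (letter_circ a b) * of_word u"
    by (simp add: stuffle_of_word)
  moreover have "of_word (b # u) = of_letter b * of_word u"
    by (simp flip: of_word_append)
  ultimately show ?case
    by (simp add: c stuffle_scalar_right mult.assoc distrib_left right_diff_distrib)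
qed

lemma stuffle_zero_right: "q \<circledast> 0 = 0"
  by (simp add: stuffle_def)

lemma stuffle_sum_right: "q \<circledast> (\<Sum>i\<in>A. f i) = (\<Sum>i\<in>A. q \<circledast> f i)"
  by (induction A rule: infinite_finite_induct) (simp_all add: stuffle_zero_right stuffle_add_right)

lemma stuffle_prod_empty: "stuffle_prod w {} = 1"
  by (simp add: stuffle_prod_def)

text \<open>The factors are folded in increasing order of index, so a new minimum becomes the
  outermost factor on the left.\<close>

lemma stuffle_prod_insert_min:
  assumes "finite S" "\<And>j. j \<in> S \<Longrightarrow> i < j"
  shows "stuffle_prod w (insert i S) = of_letter (w i) \<circledast> stuffle_prod w S"
proof -
  have "sorted_list_of_set (insert i S) = i # sorted_list_of_set S"
    using assms
    by (metis insort_is_Cons less_imp_le_nat nless_le set_sorted_list_of_set sorted_list_of_set_insert)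
  then show ?thesis by (simp add: stuffle_prod_def)
qed

text \<open>Split by whether \<open>i\<close> belongs to the subset. Without \<open>i\<close>, all
  of \<open>S\<close> is allowed; with \<open>i\<close>, the rest must be proper in
  \<open>S\<close>.\<close>

lemma psubset_insert_Collect:
  assumes "i \<notin> S"
  shows "{I. I \<subset> insert i S} = insert S ({I. I \<subset> S} \<union> insert i ` {I. I \<subset> S})"
proof (intro equalityI subsetI)
  fix I assume "I \<in> {I. I \<subset> insert i S}"
  then have I: "I \<subset> insert i S" by simp
  show "I \<in> insert S ({I. I \<subset> S} \<union> insert i ` {I. I \<subset> S})"
  proof (cases "i \<in> I")
    case True
    then have "I = insert i (I - {i})" "I - {i} \<subset> S" using I by auto
    then show ?thesis by blast
  next
    case False
    then show ?thesis using I by auto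
  qed
next
  fix I assume "I \<in> insert S ({I. I \<subset> S} \<union> insert i ` {I. I \<subset> S})"
  then show "I \<in> {I. I \<subset> insert i S}" using assms by auto
qed

lemma sum_psubset_insert:
  fixes f :: "'a set \<Rightarrow> 'b::comm_monoid_add"
  assumes "finite S" "i \<notin> S"
  shows "(\<Sum>I | I \<subset> insert i S. f I) =
    f S + (\<Sum>I | I \<subset> S. f I) + (\<Sum>I | I \<subset> S. f (insert i I))"
proof -
  have fin: "finite {I. I \<subset> S}"
    by (rule finite_subset[of _ "Pow S"]) (use assms in auto)
  have "inj_on (insert i) {I. I \<subset> S}"
    using assms(2) by (auto simp: inj_on_def insert_ident psubset_eq)
  then have "sum f (insert i ` {I. I \<subset> S}) = (\<Sum>I | I \<subset> S. f (insert i I))"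
    by (simp add: sum.reindex)
  moreover have "sum f ({I. I \<subset> S} \<union> insert i ` {I. I \<subset> S}) =
      sum f {I. I \<subset> S} + sum f (insert i ` {I. I \<subset> S})"
    using assms(2) fin by (intro sum.union_disjoint) auto
  moreover have "S \<notin> {I. I \<subset> S} \<union> insert i ` {I. I \<subset> S}"
    using assms(2) by auto
  ultimately show ?thesis
    unfolding psubset_insert_Collect[OF assms(2)] using fin by (simp add: add.assoc)
qed

lemma abs_prod_less_one:
  fixes x :: "'a \<Rightarrow> real"
  assumes "finite T" "T \<noteq> {}" "\<And>j. j \<in> T \<Longrightarrow> \<bar>x j\<bar> < 1"
  shows "\<bar>\<Prod>j\<in>T. x j\<bar> < 1"
  using assms by (induction T rule: finite_ne_induct) (simp_all add: abs_mult_less_one del: abs_mult)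

text \<open>\<open>mk_letter\<close> is specified only for positive weight and argument of modulus
  below 1. Both hold for the sum and product over \<open>T\<close> because \<open>T\<close> is
  nonempty; an empty \<open>T\<close> would give weight 0 and argument 1.\<close>

lemma letter_circ_mk_letter_insert:
  assumes "finite T" "T \<noteq> {}" "i \<notin> T"
    and k: "\<And>j. j \<in> insert i T \<Longrightarrow> 0 < k j"
    and x: "\<And>j. j \<in> insert i T \<Longrightarrow> \<bar>x j\<bar> < 1"
  shows "letter_circ (mk_letter (k i) (x i)) (mk_letter (sum k T) (prod x T)) =
    mk_letter (sum k (insert i T)) (prod x (insert i T))"
proof -
  have "\<bar>prod x T\<bar> < 1" using assms by (intro abs_prod_less_one) auto
  moreover have "0 < sum k T" using assms by (intro sum_pos) auto
  ultimately show ?thesis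
    using assms(1,3) k[of i] x[of i] by (simp add: letter_circ_mk_letter abs_less_iff)
qed

text \<open>An arbitrary finite index set lets the induction add a new minimum, and writing sign,
  weight and argument through the complement \<open>S - I\<close> shows how each changes when
  \<open>i\<close> joins \<open>S\<close> or \<open>I\<close>.\<close>

lemma stuffle_prod_eq_sum_psubset:
  fixes k :: "nat \<Rightarrow> nat" and x :: "nat \<Rightarrow> real"
  assumes "finite S" "S \<noteq> {}"
    and "\<And>i. i \<in> S \<Longrightarrow> 0 < k i" "\<And>i. i \<in> S \<Longrightarrow> \<bar>x i\<bar> < 1"
    and "\<And>i. i \<in> S \<Longrightarrow> w i = mk_letter (k i) (x i)"
  shows "stuffle_prod w S =
    (\<Sum>I | I \<subset> S. scalar ((-1) ^ (card (S - I) - 1))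
       * of_letter (mk_letter (sum k (S - I)) (prod x (S - I))) * stuffle_prod w I)"
  using assms
proof (induction S rule: finite_linorder_min_induct)
  case empty
  then show ?case by simp
next
  case (insert i S)
  define L where "L T = mk_letter (sum k T) (prod x T)" for T
  define s where "s T = scalar ((-1) ^ (card T - 1))" for T :: "nat set"
  \<comment> \<open>The sign of a singleton is 1, so \<open>w i\<close> is the coefficient belonging
    to the subset \<open>S\<close> of \<open>insert i S\<close>.\<close>
  have w: "of_letter (w i) = s {i} * of_letter (L {i})"
    using insert.prems by (simp add: s_def L_def scalar_1)
  have notin: "i \<notin> S" using insert.hyps by auto
  show ?case
  proof (cases "S = {}")
    case True
    have "of_letter (w i) \<circledast> 1 = of_letter (w i)"
      using stuffle_of_word[of "[w i]" "[]"] by (simp add: of_word_Nil)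
    moreover have "{I. I \<subset> {i}} = {{}}" by auto
    ultimately show ?thesis
      using True stuffle_prod_insert_min[of "{}" i w] insert.prems
      by (simp add: stuffle_prod_empty scalar_1)
  next
    case False
    let ?a = "of_letter (w i)" and ?P = "stuffle_prod w"
    have IH: "?P S = (\<Sum>I | I \<subset> S. s (S - I) * of_letter (L (S - I)) * ?P I)"
      using insert.IH[OF False] insert.prems by (simp add: s_def L_def)
    have step: "?a \<circledast> (s (S - I) * of_letter (L (S - I)) * ?P I) =
        ?a * (s (S - I) * of_letter (L (S - I)) * ?P I)
        + s (insert i S - insert i I) * of_letter (L (insert i S - insert i I)) * ?P (insert i I)
        + s (insert i S - I) * of_letter (L (insert i S - I)) * ?P I"
      if I: "I \<subset> S" for I
    proof -
      have T: "finite (S - I)" "S - I \<noteq> {}" "i \<notin> S - I" using I insert.hyps notin by auto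
      have eq: "insert i S - insert i I = S - I" "insert i S - I = insert i (S - I)"
        using I notin by auto
      have circ: "letter_circ (w i) (L (S - I)) = L (insert i (S - I))"
      proof -
        have "w i = mk_letter (k i) (x i)" using insert.prems by simp
        moreover have "letter_circ (mk_letter (k i) (x i)) (L (S - I)) = L (insert i (S - I))"
          unfolding L_def using insert.prems(2,3)
          by (intro letter_circ_mk_letter_insert[OF T]) blast+
        ultimately show ?thesis by simp
      qed
      have P: "?P (insert i I) = ?a \<circledast> ?P I"
        using I insert.hyps by (intro stuffle_prod_insert_min) (auto intro: finite_subset)
      \<comment> \<open>As the complement is nonempty, the \<open>- 1\<close> in the exponent does
        not truncate, and adding \<open>i\<close> flips the sign.\<close>
      have "card (S - I) \<noteq> 0" using T by simp
      then have sgn: "s (insert i (S - I)) = - s (S - I)"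
        using T by (cases "card (S - I)") (simp_all add: s_def scalar_minus)
      have comm: "?a * s (S - I) = s (S - I) * ?a"
        by (simp add: s_def of_word_scalar_commute)
      have "?a \<circledast> (s (S - I) * (of_letter (L (S - I)) * ?P I)) =
          s (S - I) * (?a \<circledast> (of_letter (L (S - I)) * ?P I))"
        by (simp add: s_def stuffle_scalar_right)
      also have "\<dots> = (s (S - I) * ?a) * of_letter (L (S - I)) * ?P I
          + s (S - I) * of_letter (L (S - I)) * ?P (insert i I)
          + s (insert i (S - I)) * of_letter (L (insert i (S - I))) * ?P I"
        by (simp add: stuffle_letter_mult circ P sgn algebra_simps)
      finally show ?thesis by (simp add: eq mult.assoc flip: comm)
    qed
    have "?P (insert i S) = ?a \<circledast> ?P S"
      using insert.hyps by (intro stuffle_prod_insert_min) auto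
    \<comment> \<open>The first terms of \<open>step\<close> recombine to \<open>?a * ?P S\<close>
      by \<open>IH\<close>.\<close>
    also have "\<dots> = ?a * ?P S
        + (\<Sum>I | I \<subset> S. s (insert i S - insert i I) * of_letter (L (insert i S - insert i I))
            * ?P (insert i I))
        + (\<Sum>I | I \<subset> S. s (insert i S - I) * of_letter (L (insert i S - I)) * ?P I)"
      by (simp add: IH stuffle_sum_right step sum.distrib sum_distrib_left)
    also have "?a = s (insert i S - S) * of_letter (L (insert i S - S))"
      using w notin by (simp add: insert_Diff_if)
    finally show ?thesis
      using sum_psubset_insert[OF insert.hyps(1) notin,
          of "\<lambda>I. s (insert i S - I) * of_letter (L (insert i S - I)) * ?P I"]
      unfolding s_def L_def by (simp only: ac_simps)
  qed
qed

theorem theorem3p3: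
  fixes n :: nat and k :: "nat \<Rightarrow> nat" and x :: "nat \<Rightarrow> real" and w :: "nat \<Rightarrow> letter"
  assumes "0 < n"
    and "\<And>i. i \<in> {1..n} \<Longrightarrow> 0 < k i"
    and "\<And>i. i \<in> {1..n} \<Longrightarrow> -1 < x i \<and> x i < 1"
    and "\<And>i. i \<in> {1..n} \<Longrightarrow> w i = mk_letter (k i) (x i)"
  shows "stuffle_prod w {1..n} =
    (\<Sum>I | I \<subset> {1..n}.
       scalar ((-1) ^ (n - card I - 1))
       * of_letter (mk_letter ((\<Sum>i=1..n. k i) - (\<Sum>i\<in>I. k i)) (\<Prod>i\<in>{1..n} - I. x i))
       * stuffle_prod w I)"
proof -
  \<comment> \<open>The inclusion of \<open>I\<close> makes these natural-number subtractions
    exact.\<close>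
  have "card ({1..n} - I) = n - card I" "sum k ({1..n} - I) = sum k {1..n} - sum k I"
    if "I \<subset> {1..n}" for I
  proof -
    have "I \<subseteq> {1..n}" "finite I" using that by (auto intro: finite_subset)
    then show "card ({1..n} - I) = n - card I" "sum k ({1..n} - I) = sum k {1..n} - sum k I"
      by (simp_all add: card_Diff_subset sum_diff_nat)
  qed
  moreover have "stuffle_prod w {1..n} =
    (\<Sum>I | I \<subset> {1..n}. scalar ((-1) ^ (card ({1..n} - I) - 1))
       * of_letter (mk_letter (sum k ({1..n} - I)) (prod x ({1..n} - I))) * stuffle_prod w I)"
    using assms by (intro stuffle_prod_eq_sum_psubset) (auto simp: abs_less_iff)
  ultimately show ?thesis by simp
qed

end
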